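(* Let $\phi=(1+\sqrt5)/2$ and let $X_{\mathrm{BH}}\subset\mathbb{P}^5(\mathbb{C})$ be the K3 surface defined by $$x_1^2+x_4^2-\phi x_5^2+\phi x_6^2=0,\quad x_2^2-\phi x_4^2+x_5^2-\phi x_6^2=0,\quad x_3^2+\phi x_4^2-\phi x_5^2+x_6^2=0.$$ Let $C\subset\mathbb{P}^5(\mathbb{C})$ be the conic defined by $x_5=\sqrt\phi\,x_1$, $x_4=\sqrt\phi\,x_2$, $x_3=\sqrt\phi\,x_6$, $x_1^2-x_2^2-x_6^2=0$, and let $\mathcal{A}\subset\mathrm{GL}_6(\mathbb{C})$ be the group generated by the four matrices $$\begin{pmatrix}0&0&1&0&0&0\\0&0&0&0&i&0\\-1&0&0&0&0&0\\0&0&0&i&0&0\\0&i&0&0&0&0\\0&0&0&0&0&-i\end{pmatrix},\quad\begin{pmatrix}0&0&-i&0&0&0\\0&-i&0&0&0&0\\-i&0&0&0&0&0\\0&0&0&0&0&-i\\0&0&0&0&i&0\\0&0&0&-i&0&0\end{pmatrix},$$ $$\mathrm{diag}(1,1,1,-1,1,-1),\qquad \mathrm{diag}(1,-1,1,-1,-1,-1).$$ Then $C$ is contained in $X_{\mathrm{BH}}$, its $G_{\mathrm{BH}}$-orbit contains $80$ elements, and its $\mathcal{A}$-orbit contains $16$ elements which are two by two disjoint.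
   Context: $\mathcal{A}$ is a subgroup of $G_{\mathrm{BH}}$, where $G_{\mathrm{BH}}\subset\mathrm{GL}_6(\mathbb{C})$ is the group (of order $3840$, stabilizing $X_{\mathrm{BH}}$) generated by $\mathrm{diag}(-1,1,1,1,1,1)$, $$u=\begin{pmatrix}i&0&0&0&0&0\\0&0&1&0&0&0\\0&1&0&0&0&0\\0&0&0&-i&0&0\\0&0&0&0&0&1\\0&0&0&0&1&0\end{pmatrix},\qquad v=\begin{pmatrix}0&0&0&0&0&1\\1&0&0&0&0&0\\0&1&0&0&0&0\\0&0&1&0&0&0\\0&0&0&0&1&0\\0&0&0&1&0&0\end{pmatrix}.$$ $\mathrm{GL}_6(\mathbb{C})$ acts on $\mathbb{P}^5(\mathbb{C})$ in the natural way. *)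

theory Defs
  imports
    "HOL-Analysis.Analysis"
    "HOL-Algebra.Generated_Groups"
    "HOL-Algebra.Group_Action"
begin

(* Coordinates of complex^6 are x $ 1, ..., x $ 6; in the six-element index type
   the numeral 6 equals 0.  The following shows that the library's "vector"
   nevertheless lists entries in the usual order, so that
   "vector [row1, ..., row6]" is the matrix with these rows. *)

lemma vector_6:
  "(vector [a, b, c, d, e, f] :: 'a::zero ^ 6) $ 1 = a"
  "(vector [a, b, c, d, e, f] :: 'a::zero ^ 6) $ 2 = b"
  "(vector [a, b, c, d, e, f] :: 'a::zero ^ 6) $ 3 = c"
  "(vector [a, b, c, d, e, f] :: 'a::zero ^ 6) $ 4 = d"
  "(vector [a, b, c, d, e, f] :: 'a::zero ^ 6) $ 5 = e"
  "(vector [a, b, c, d, e, f] :: 'a::zero ^ 6) $ 6 = f"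
  unfolding vector_def by simp_all

definition diag_matrix :: "complex ^ 6 \<Rightarrow> complex ^ 6 ^ 6" where
  "diag_matrix d = (\<chi> i j. if i = j then d $ i else 0)"

definition GL6 :: "(complex ^ 6 ^ 6) monoid" where
  "GL6 = \<lparr>carrier = {g. invertible g}, mult = (**), one = mat 1\<rparr>"

lemma group_GL6: "group GL6"
proof (rule groupI)
  show "\<one>\<^bsub>GL6\<^esub> \<in> carrier GL6"
    by (auto simp: GL6_def invertible_def intro!: exI[of _ "mat 1"])
next
  fix g assume "g \<in> carrier GL6"
  then obtain h where "g ** h = mat 1" "h ** g = mat 1"
    by (auto simp: GL6_def invertible_def)
  then show "\<exists>h\<in>carrier GL6. h \<otimes>\<^bsub>GL6\<^esub> g = \<one>\<^bsub>GL6\<^esub>"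
    by (auto simp: GL6_def invertible_def)
qed (auto simp: GL6_def invertible_mult matrix_mul_assoc)

(* Points of P^5(C) are the one-dimensional linear subspaces of C^6. *)

definition P5 :: "(complex ^ 6) set set" where
  "P5 = {vec.span {x} | x. x \<noteq> 0}"

definition proj_zeros :: "(complex ^ 6 \<Rightarrow> complex) set \<Rightarrow> (complex ^ 6) set set" where
  "proj_zeros F = {L \<in> P5. \<forall>x\<in>L. \<forall>f\<in>F. f x = 0}"

definition act_point :: "complex ^ 6 ^ 6 \<Rightarrow> (complex ^ 6) set \<Rightarrow> (complex ^ 6) set" where
  "act_point g L = (\<lambda>x. g *v x) ` L"

definition act_subset :: "complex ^ 6 ^ 6 \<Rightarrow> (complex ^ 6) set set \<Rightarrow> (complex ^ 6) set set" where
  "act_subset g Y = act_point g ` Y"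

definition phi :: real where
  "phi = (1 + sqrt 5) / 2"

definition X_BH :: "(complex ^ 6) set set" where
  "X_BH = proj_zeros
    {\<lambda>x. (x $ 1)\<^sup>2 + (x $ 4)\<^sup>2 - of_real phi * (x $ 5)\<^sup>2 + of_real phi * (x $ 6)\<^sup>2,
     \<lambda>x. (x $ 2)\<^sup>2 - of_real phi * (x $ 4)\<^sup>2 + (x $ 5)\<^sup>2 - of_real phi * (x $ 6)\<^sup>2,
     \<lambda>x. (x $ 3)\<^sup>2 + of_real phi * (x $ 4)\<^sup>2 - of_real phi * (x $ 5)\<^sup>2 + (x $ 6)\<^sup>2}"

definition C_conic :: "(complex ^ 6) set set" where
  "C_conic = proj_zeros
    {\<lambda>x. x $ 5 - of_real (sqrt phi) * x $ 1,
     \<lambda>x. x $ 4 - of_real (sqrt phi) * x $ 2,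
     \<lambda>x. x $ 3 - of_real (sqrt phi) * x $ 6,
     \<lambda>x. (x $ 1)\<^sup>2 - (x $ 2)\<^sup>2 - (x $ 6)\<^sup>2}"

definition mat_u :: "complex ^ 6 ^ 6" where
  "mat_u = vector
    [vector [\<i>, 0, 0,  0, 0, 0],
     vector [0, 0, 1,  0, 0, 0],
     vector [0, 1, 0,  0, 0, 0],
     vector [0, 0, 0, -\<i>, 0, 0],
     vector [0, 0, 0,  0, 0, 1],
     vector [0, 0, 0,  0, 1, 0]]"

definition mat_v :: "complex ^ 6 ^ 6" where
  "mat_v = vector
    [vector [0, 0, 0, 0, 0, 1],
     vector [1, 0, 0, 0, 0, 0],
     vector [0, 1, 0, 0, 0, 0],
     vector [0, 0, 1, 0, 0, 0],
     vector [0, 0, 0, 0, 1, 0],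
     vector [0, 0, 0, 1, 0, 0]]"

definition G_BH :: "(complex ^ 6 ^ 6) monoid" where
  "G_BH = GL6\<lparr>carrier := generate GL6
     {diag_matrix (vector [-1, 1, 1, 1, 1, 1]), mat_u, mat_v}\<rparr>"

definition mat_a :: "complex ^ 6 ^ 6" where
  "mat_a = vector
    [vector [ 0, 0, 1, 0, 0,  0],
     vector [ 0, 0, 0, 0, \<i>,  0],
     vector [-1, 0, 0, 0, 0,  0],
     vector [ 0, 0, 0, \<i>, 0,  0],
     vector [ 0, \<i>, 0, 0, 0,  0],
     vector [ 0, 0, 0, 0, 0, -\<i>]]"

definition mat_b :: "complex ^ 6 ^ 6" where
  "mat_b = vector
    [vector [ 0,  0, -\<i>,  0, 0,  0],
     vector [ 0, -\<i>,  0,  0, 0,  0],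
     vector [-\<i>,  0,  0,  0, 0,  0],
     vector [ 0,  0,  0,  0, 0, -\<i>],
     vector [ 0,  0,  0,  0, \<i>,  0],
     vector [ 0,  0,  0, -\<i>, 0,  0]]"

definition A_grp :: "(complex ^ 6 ^ 6) monoid" where
  "A_grp = GL6\<lparr>carrier := generate GL6
     {mat_a, mat_b,
      diag_matrix (vector [1, 1, 1, -1, 1, -1]),
      diag_matrix (vector [1, -1, 1, -1, -1, -1])}\<rparr>"

end

(* The generators are monomial matrices that preserve the equations of X_BH. The conic is the
   intersection of X_BH with the plane given by three equations x_b = sqrt phi * x_a, so every
   translate is the intersection of X_BH with a plane given by three equations
   x_b = i^c * sqrt phi * x_a, and it is determined by them because these are all the equations of
   this shape that hold on it. The orbits of the conic are thus in bijection with the orbits of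
   the finite set of triples (a, b, c), which are computed by closing off under the generators.
   By homogeneity the translates under the second group are pairwise disjoint as soon as the conic
   is disjoint from its 15 other translates; this is linear algebra, except where the two planes
   meet in a point, which lies off the quadric. *)

theory Submission
  imports Defs "HOL-Library.While_Combinator"
begin

section \<open>The six-element index type and coordinates\<close>

lemma exhaust_6: "x = 1 \<or> x = 2 \<or> x = 3 \<or> x = 4 \<or> x = 5 \<or> x = 6" for x :: 6
proof (induct x)
  case (of_int z)
  \<comment> \<open>The representative 0 stands for the index 6, which is the same element of this
    type.\<close>
  then have "z = 0 \<or> z = 1 \<or> z = 2 \<or> z = 3 \<or> z = 4 \<or> z = 5" by auto
  then show ?case by auto
qed

lemma UNIV_6: "(UNIV :: 6 set) = {1, 2, 3, 4, 5, 6}"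
  using exhaust_6 by auto

lemma sum_6: "sum f (UNIV :: 6 set) = f 1 + f 2 + f 3 + f 4 + f 5 + f 6"
  unfolding UNIV_6 by (simp add: add_ac)

text \<open>Coordinates are counted from 0 here: \<open>coord x k\<close> is the paper's \<open>x\<^sub>k\<^sub>+\<^sub>1\<close>.\<close>

definition coord :: "complex ^ 6 \<Rightarrow> nat \<Rightarrow> complex" where
  "coord x k = x $ of_nat (Suc k)"

lemma coord_simps [simp]:
  "coord x 0 = x $ 1" "coord x 1 = x $ 2" "coord x (Suc 0) = x $ 2" "coord x 2 = x $ 3" "coord x 3 = x $ 4"
  "coord x 4 = x $ 5" "coord x 5 = x $ 6"
  by (simp_all add: coord_def)

lemma all_less_6: "(\<forall>k<6. P k) \<longleftrightarrow> P 0 \<and> P 1 \<and> P 2 \<and> P 3 \<and> P 4 \<and> P (5::nat)"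
  by (simp add: numeral_eq_Suc All_less_Suc2)

lemma forall_6: "(\<forall>i::6. P i) \<longleftrightarrow> P 1 \<and> P 2 \<and> P 3 \<and> P 4 \<and> P 5 \<and> P 6"
proof -
  have "(\<forall>i::6. P i) \<longleftrightarrow> (\<forall>i\<in>{1, 2, 3, 4, 5, 6}. P i)"
    by (simp flip: UNIV_6)
  then show ?thesis by simp
qed

lemma vec_eq_coord: "x = y \<longleftrightarrow> (\<forall>k<6. coord x k = coord y k)"
  unfolding all_less_6 vec_eq_iff forall_6 by simp

section \<open>The golden ratio and the symmetries of the three quadrics\<close>

lemma phi_sq: "phi\<^sup>2 = phi + 1"
  unfolding phi_def by (simp add: power2_eq_square field_simps)

lemma complex_phi_sq: "(of_real phi :: complex) * of_real phi = of_real phi + 1"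
  by (metis of_real_1 of_real_add of_real_mult phi_sq power2_eq_square)

text \<open>The arguments stand for the squares of the coordinates: the quadrics are linear in
  these, and a power of \<open>\<i>\<close> scaling a coordinate only changes a sign.\<close>

definition X_system :: "complex \<Rightarrow> complex \<Rightarrow> complex \<Rightarrow> complex \<Rightarrow> complex \<Rightarrow> complex \<Rightarrow> complex \<Rightarrow> bool" where
  "X_system p a b c d e f \<longleftrightarrow>
    a + d - p * e + p * f = 0 \<and> b - p * d + e - p * f = 0 \<and> c + p * d - p * e + f = 0"

text \<open>The substitution negates the first equation and swaps the other two, so it works for
  every \<open>p\<close>.\<close>

lemma X_system_u: "X_system p (- a) c b (- d) f e \<longleftrightarrow> X_system p a b c d e f"
  unfolding X_system_def by (auto simp: algebra_simps eq_neg_iff_add_eq_0)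

context
  fixes p :: complex
  assumes p: "p * p = p + 1"
begin

text \<open>Modulo \<open>p * p = p + 1\<close>, each of the two systems consists of linear
  combinations of the equations of the other.\<close>

lemma X_system_v: "X_system p f a b c e d \<longleftrightarrow> X_system p a b c d e f"
proof
  show "X_system p f a b c e d" if "X_system p a b c d e f"
    using p that unfolding X_system_def by (elim conjE; intro conjI; algebra)
  show "X_system p a b c d e f" if "X_system p f a b c e d"
    using p that unfolding X_system_def by (elim conjE; intro conjI; algebra)
qed

text \<open>The substitution is an involution, so one implication, used also at the substituted
  arguments, gives both directions.\<close>

lemma X_system_a: "X_system p c (- e) a (- d) (- b) (- f) \<longleftrightarrow> X_system p a b c d e f"
proof -
  have "X_system p c (- e) a (- d) (- b) (- f)" if "X_system p a b c d e f" for a b c d e f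
    using p that unfolding X_system_def by (elim conjE; intro conjI; algebra)
  from this [of c "- e" a "- d" "- b" "- f"] this [of a b c d e f] show ?thesis by auto
qed

lemma X_system_b: "X_system p (- c) (- b) (- a) (- f) (- e) (- d) \<longleftrightarrow> X_system p a b c d e f"
proof -
  have "X_system p (- c) (- b) (- a) (- f) (- e) (- d)" if "X_system p a b c d e f" for a b c d e f
    using p that unfolding X_system_def by (elim conjE; intro conjI; algebra)
  from this [of "- c" "- b" "- a" "- f" "- e" "- d"] this [of a b c d e f] show ?thesis by auto
qed

text \<open>On the plane of the conic, each of the three quadrics is a multiple of the one defining the conic.\<close>

lemma X_system_plane:
  "p \<noteq> 0 \<Longrightarrow> X_system p a b (p * c) (p * b) (p * a) c \<longleftrightarrow> a - b - c = 0"
proof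
  assume "X_system p a b (p * c) (p * b) (p * a) c"
  then have "p * (a - b - c) = 0"
    using p unfolding X_system_def by algebra
  then show "a - b - c = 0" if "p \<noteq> 0"
    using that by simp
next
  assume "a - b - c = 0"
  then show "X_system p a b (p * c) (p * b) (p * a) c"
    using p unfolding X_system_def by (intro conjI; algebra)
qed

end

section \<open>Monomial matrices and the generators\<close>

definition on_X :: "complex ^ 6 \<Rightarrow> bool" where
  "on_X x \<longleftrightarrow> X_system (of_real phi) ((x $ 1)\<^sup>2) ((x $ 2)\<^sup>2) ((x $ 3)\<^sup>2) ((x $ 4)\<^sup>2) ((x $ 5)\<^sup>2) ((x $ 6)\<^sup>2)"

text \<open>The list is an executable code for the matrix: entry \<open>k\<close> holds the row of
  the nonzero entry in column \<open>k\<close>, both counted from 0, and its exponent as a power of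
  \<open>\<i>\<close>.\<close>

definition monomial :: "(nat \<times> nat) list \<Rightarrow> complex ^ 6 ^ 6 \<Rightarrow> bool" where
  "monomial m g \<longleftrightarrow> length m = 6 \<and> fst ` set m = {..<6} \<and>
    (\<forall>x. \<forall>k<6. coord (g *v x) (fst (m ! k)) = \<i> ^ snd (m ! k) * coord x k) \<and>
    (\<forall>x. on_X (g *v x) \<longleftrightarrow> on_X x)"

text \<open>A triple \<open>(a, b, c)\<close> encodes the linear equation \<open>x\<^sub>b = \<i>\<^sup>c sqrt \<phi> x\<^sub>a\<close>; the term
  \<open>3 * snd (m ! a)\<close> is \<open>- snd (m ! a)\<close> modulo 4 without truncated subtraction.\<close>

fun move :: "(nat \<times> nat) list \<Rightarrow> nat \<times> nat \<times> nat \<Rightarrow> nat \<times> nat \<times> nat" where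
  "move m (a, b, c) = (fst (m ! a), fst (m ! b), (c + snd (m ! b) + 3 * snd (m ! a)) mod 4)"

lemmas matrix_vector_6 = matrix_vector_mult_def sum_6 vector_6

lemma on_X_generators:
  "on_X (diag_matrix (vector [-1, 1, 1, 1, 1, 1]) *v x) \<longleftrightarrow> on_X x"
  "on_X (mat_u *v x) \<longleftrightarrow> on_X x"
  "on_X (mat_v *v x) \<longleftrightarrow> on_X x"
  "on_X (mat_a *v x) \<longleftrightarrow> on_X x"
  "on_X (mat_b *v x) \<longleftrightarrow> on_X x"
  "on_X (diag_matrix (vector [1, 1, 1, -1, 1, -1]) *v x) \<longleftrightarrow> on_X x"
  "on_X (diag_matrix (vector [1, -1, 1, -1, -1, -1]) *v x) \<longleftrightarrow> on_X x"
  unfolding on_X_def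
  by (simp_all add: matrix_vector_6 diag_matrix_def mat_u_def mat_v_def mat_a_def mat_b_def
      power_mult_distrib)
    (rule X_system_u X_system_v X_system_a X_system_b complex_phi_sq)+

lemmas generator_simps = matrix_vector_6 diag_matrix_def mat_u_def mat_v_def mat_a_def mat_b_def
  power3_eq_cube

lemma monomial_G_generators:
  "monomial [(0, 2), (1, 0), (2, 0), (3, 0), (4, 0), (5, 0)] (diag_matrix (vector [-1, 1, 1, 1, 1, 1]))"
  "monomial [(0, 1), (2, 0), (1, 0), (3, 3), (5, 0), (4, 0)] mat_u"
  "monomial [(1, 0), (2, 0), (3, 0), (5, 0), (4, 0), (0, 0)] mat_v"
  unfolding monomial_def all_less_6 on_X_generators by (auto simp: generator_simps)

lemma monomial_A_generators:
  "monomial [(2, 2), (4, 1), (0, 0), (3, 1), (1, 1), (5, 3)] mat_a"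
  "monomial [(2, 3), (1, 3), (0, 3), (5, 3), (4, 1), (3, 3)] mat_b"
  "monomial [(0, 0), (1, 0), (2, 0), (3, 2), (4, 0), (5, 2)] (diag_matrix (vector [1, 1, 1, -1, 1, -1]))"
  "monomial [(0, 0), (1, 2), (2, 0), (3, 2), (4, 2), (5, 2)] (diag_matrix (vector [1, -1, 1, -1, -1, -1]))"
  unfolding monomial_def all_less_6 on_X_generators by (auto simp: generator_simps)

section \<open>The action on points and subsets of projective space\<close>

lemma act_point_mult: "act_point (g ** h) L = act_point g (act_point h L)"
  by (simp add: act_point_def image_image matrix_vector_mul_assoc)

lemma act_point_one: "act_point (mat 1) L = L"
  by (simp add: act_point_def)

lemma act_subset_mult: "act_subset (g ** h) Y = act_subset g (act_subset h Y)"
  by (simp add: act_subset_def image_image act_point_mult)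

lemma act_subset_one: "act_subset (mat 1) Y = Y"
  by (simp add: act_subset_def act_point_one)

lemma act_point_P5:
  assumes "invertible g" and "L \<in> P5"
  shows "act_point g L \<in> P5"
proof -
  obtain x where x: "L = vec.span {x}" "x \<noteq> 0"
    using assms(2) unfolding P5_def by blast
  moreover have "g *v x \<noteq> 0"
    using assms(1) x(2) by (meson invertible_left_inverse matrix_left_invertible_ker)
  moreover have "act_point g L = vec.span {g *v x}"
    using vec.span_image[of g "{x}"] by (simp add: act_point_def x)
  ultimately show ?thesis
    unfolding P5_def by blast
qed

lemma act_subset_Collect:
  assumes g: "invertible g" and "\<And>x. Q (g *v x) \<longleftrightarrow> P x"
  shows "act_subset g {L \<in> P5. \<forall>x\<in>L. P x} = {L \<in> P5. \<forall>x\<in>L. Q x}"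
proof -
  obtain h where h: "g ** h = mat 1" "h ** g = mat 1"
    using g unfolding invertible_def by blast
  have "L \<in> act_subset g {L \<in> P5. \<forall>x\<in>L. P x}" if "L \<in> P5" "\<forall>x\<in>L. Q x" for L
  proof -
    have L: "L = act_point g (act_point h L)"
      by (simp flip: act_point_mult add: h act_point_one)
    moreover have "act_point h L \<in> P5"
      using h that(1) by (auto intro!: act_point_P5 simp: invertible_def)
    moreover have "\<forall>x\<in>act_point h L. P x"
      using L that(2) assms(2) unfolding act_point_def by blast
    ultimately show ?thesis
      unfolding act_subset_def by blast
  qed
  moreover have "act_point g L \<in> P5 \<and> (\<forall>x\<in>act_point g L. Q x)" if "L \<in> P5" "\<forall>x\<in>L. P x" for L
    using that assms by (auto simp: act_point_P5) (auto simp: act_point_def)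
  ultimately show ?thesis
    unfolding act_subset_def by blast
qed

text \<open>The kernel is trivial: up to a nonzero factor, each coordinate of \<open>x\<close> is a
  coordinate of \<open>g *v x\<close>.\<close>

lemma monomial_invertible:
  assumes "monomial m g"
  shows "invertible g"
proof -
  have "x = 0" if "g *v x = 0" for x
  proof -
    have "coord x k = 0" if "k < 6" for k
    proof -
      have "\<i> ^ snd (m ! k) * coord x k = coord 0 (fst (m ! k))"
        using assms \<open>g *v x = 0\<close> that unfolding monomial_def by metis
      then show ?thesis
        by (simp add: coord_def)
    qed
    then show ?thesis
      by (simp add: vec_eq_coord) (simp add: coord_def)
  qed
  then show ?thesis
    by (simp add: invertible_left_inverse matrix_left_invertible_ker)
qed

section \<open>Transport of the linear equations\<close>

definition admissible :: "(nat \<times> nat \<times> nat) set" where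
  "admissible = {..<6} \<times> {..<6} \<times> {..<4}"

fun holds :: "complex ^ 6 \<Rightarrow> nat \<times> nat \<times> nat \<Rightarrow> bool" where
  "holds x (a, b, c) \<longleftrightarrow> coord x b = \<i> ^ c * of_real (sqrt phi) * coord x a"

lemma i_power_mod_4: "\<i> ^ (n mod 4) = \<i> ^ n"
proof -
  have "\<i> ^ n = \<i> ^ (4 * (n div 4) + n mod 4)"
    by simp
  then show ?thesis
    unfolding power_add power_mult by simp
qed

lemma
  assumes "monomial m g" "a < 6"
  shows monomial_length: "length m = 6" and monomial_less: "fst (m ! a) < 6"
proof -
  show "length m = 6"
    using assms by (simp add: monomial_def)
  then have "fst (m ! a) \<in> fst ` set m"
    using assms(2) by (intro imageI nth_mem) simp
  then show "fst (m ! a) < 6"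
    using assms unfolding monomial_def by (metis lessThan_iff)
qed

lemma move_admissible: "monomial m g \<Longrightarrow> t \<in> admissible \<Longrightarrow> move m t \<in> admissible"
  by (auto simp: admissible_def monomial_less)

text \<open>In the new coordinates the equation is the old one multiplied by the power of
  \<open>\<i>\<close> that scales its left-hand side, a nonzero factor.\<close>

lemma holds_move:
  assumes g: "monomial m g" and "t \<in> admissible"
  shows "holds (g *v x) (move m t) \<longleftrightarrow> holds x t"
proof -
  obtain a b c where t: "t = (a, b, c)" "a < 6" "b < 6"
    using assms(2) unfolding admissible_def by auto
  define ea eb where "ea = snd (m ! a)" and "eb = snd (m ! b)"
  have ea: "coord (g *v x) (fst (m ! a)) = \<i> ^ ea * coord x a"
    and eb: "coord (g *v x) (fst (m ! b)) = \<i> ^ eb * coord x b"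
    using g t unfolding monomial_def ea_def eb_def by blast+
  have "\<i> ^ (c + eb + 3 * ea) * \<i> ^ ea = \<i> ^ eb * \<i> ^ c * (\<i> ^ 4) ^ ea"
    by (simp only: power_add [symmetric] power_mult [symmetric]) (simp add: ac_simps)
  then have "\<i> ^ (c + eb + 3 * ea) * \<i> ^ ea = \<i> ^ eb * \<i> ^ c"
    by simp
  then have *: "\<i> ^ (c + eb + 3 * ea) * of_real (sqrt phi) * (\<i> ^ ea * coord x a) =
      \<i> ^ eb * (\<i> ^ c * of_real (sqrt phi) * coord x a)"
    by (metis mult.assoc mult.left_commute)
  have "holds (g *v x) (move m t) \<longleftrightarrow>
      \<i> ^ eb * coord x b = \<i> ^ (c + eb + 3 * ea) * of_real (sqrt phi) * (\<i> ^ ea * coord x a)"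
    using ea eb unfolding t ea_def eb_def by (simp add: i_power_mod_4)
  then show ?thesis
    unfolding * by (simp add: t)
qed

lemma move_surj:
  assumes g: "monomial m g" and "t \<in> admissible"
  shows "\<exists>t'\<in>admissible. move m t' = t"
proof -
  obtain a b c where t: "t = (a, b, c)" "a < 6" "b < 6" "c < 4"
    using assms(2) unfolding admissible_def by auto
  have "\<exists>k<6. fst (m ! k) = j" if "j < 6" for j
  proof -
    have "j \<in> fst ` set m"
      using g that unfolding monomial_def by (metis lessThan_iff)
    moreover have "length m = 6"
      using g by (simp add: monomial_def)
    ultimately show ?thesis
      by (metis imageE in_set_conv_nth)
  qed
  then obtain a' b' where ab: "a' < 6" "b' < 6" "fst (m ! a') = a" "fst (m ! b') = b"
    using t by metis
  \<comment> \<open>This exponent undoes the shift made by \<open>move\<close>: together the two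
    shifts are a multiple of 4.\<close>
  let ?c = "(c + snd (m ! a') + 3 * snd (m ! b')) mod 4"
  have "(?c + snd (m ! b') + 3 * snd (m ! a')) mod 4 = (c + 4 * (snd (m ! a') + snd (m ! b'))) mod 4"
    by (simp only: add.assoc mod_add_left_eq) (simp add: algebra_simps)
  then have "(?c + snd (m ! b') + 3 * snd (m ! a')) mod 4 = c"
    using t(4) by (simp only: mod_mult_self2 mod_less)
  then have "move m (a', b', ?c) = t" "(a', b', ?c) \<in> admissible"
    using ab t by (auto simp: admissible_def)
  then show ?thesis by blast
qed

section \<open>From sets of triples to subsets, and back\<close>

definition realize :: "(nat \<times> nat \<times> nat) set \<Rightarrow> (complex ^ 6) set set" where
  "realize T = {L \<in> P5. \<forall>x\<in>L. on_X x \<and> (\<forall>t\<in>T. holds x t)}"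

text \<open>Passing back from a subset to all triples valid on it tells translates apart, since
  equal subsets have equal relations.\<close>

definition relations :: "(complex ^ 6) set set \<Rightarrow> (nat \<times> nat \<times> nat) set" where
  "relations Y = {t \<in> admissible. \<forall>L\<in>Y. \<forall>x\<in>L. holds x t}"

lemma act_subset_realize:
  assumes "monomial m g" and "T \<subseteq> admissible"
  shows "act_subset g (realize T) = realize (move m ` T)"
  unfolding realize_def
proof (rule act_subset_Collect)
  show "invertible g"
    using assms(1) by (rule monomial_invertible)
  have "on_X (g *v x) \<longleftrightarrow> on_X x" for x
    using assms(1) by (simp add: monomial_def)
  then show "on_X (g *v x) \<and> (\<forall>t\<in>move m ` T. holds (g *v x) t) \<longleftrightarrow>
      on_X x \<and> (\<forall>t\<in>T. holds x t)" for x
    using holds_move[OF assms(1)] assms(2) by blast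
qed

text \<open>A triple holds on \<open>Y\<close> exactly when its move holds on the translate, and by
  surjectivity of \<open>move\<close> no admissible triple on the translate is missed.\<close>

lemma relations_act_subset:
  assumes "monomial m g"
  shows "relations (act_subset g Y) = move m ` relations Y"
proof -
  have *: "move m t \<in> relations (act_subset g Y) \<longleftrightarrow> t \<in> relations Y" if "t \<in> admissible" for t
    using that holds_move[OF assms that] move_admissible[OF assms that]
    by (simp add: relations_def act_subset_def act_point_def)
  have adm: "relations Z \<subseteq> admissible" for Z
    by (auto simp: relations_def)
  show ?thesis
  proof (intro equalityI subsetI)
    fix t assume t: "t \<in> relations (act_subset g Y)"
    then obtain t' where "t' \<in> admissible" "move m t' = t"
      using move_surj[OF assms] adm by blast
    then show "t \<in> move m ` relations Y"
      using t * by blast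
  next
    fix t assume "t \<in> move m ` relations Y"
    then show "t \<in> relations (act_subset g Y)"
      using * adm by blast
  qed
qed

section \<open>The conic and the equations that hold on it\<close>

definition base :: "(nat \<times> nat \<times> nat) set" where
  "base = {(0, 4, 0), (1, 3, 0), (5, 2, 0)}"

lemma csqrt_phi_sq: "(of_real (sqrt phi) :: complex) * of_real (sqrt phi) = of_real phi"
  by (simp flip: of_real_mult add: phi_def)

lemma phi_bounds: "161 / 100 < phi" "phi < 162 / 100"
proof -
  have "2.22 < sqrt 5" "sqrt 5 < 2.24"
    by (intro real_less_rsqrt real_less_lsqrt; simp add: power2_eq_square)+
  then show "161 / 100 < phi" "phi < 162 / 100"
    by (auto simp: phi_def)
qed

text \<open>Tight enough to separate \<open>sqrt phi\<close> from 5/4 and 4/3, the nearest ratios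
  among the integers 3, 4, 5 used for the witness.\<close>

lemma sqrt_phi_bounds: "126 / 100 < sqrt phi" "sqrt phi < 128 / 100"
proof -
  show "126 / 100 < sqrt phi"
    using phi_bounds by (intro real_less_rsqrt) (simp add: power2_eq_square)
  show "sqrt phi < 128 / 100"
    using phi_bounds by (intro real_less_lsqrt) (simp_all add: power2_eq_square)
qed

text \<open>On the plane, being on the surface is equivalent to the quadric of the conic, so the
  three linear equations suffice to encode it.\<close>

lemma C_conic_eq: "C_conic = realize base"
proof -
  have "on_X x \<longleftrightarrow> (x $ 1)\<^sup>2 - (x $ 2)\<^sup>2 - (x $ 6)\<^sup>2 = 0"
    if "x $ 5 = s * x $ 1" "x $ 4 = s * x $ 2" "x $ 3 = s * x $ 6" "s * s = of_real phi"
    for x and s :: complex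
  proof -
    have "(s * z)\<^sup>2 = of_real phi * z\<^sup>2" for z
      using that(4) by (simp add: power2_eq_square algebra_simps)
    then show ?thesis
      using X_system_plane [OF complex_phi_sq] phi_bounds by (simp add: on_X_def that)
  qed
  then show ?thesis
    unfolding C_conic_def realize_def proj_zeros_def base_def
    using csqrt_phi_sq by (intro Collect_cong) (auto 4 3)
qed

text \<open>A single point of the conic, with positive coordinates (from \<open>5\<^sup>2 = 3\<^sup>2 + 4\<^sup>2\<close>), already
  violates every equation \<open>x\<^sub>b = \<i>\<^sup>c sqrt \<phi> x\<^sub>a\<close> other than the three defining the plane.\<close>

definition witness :: "nat \<Rightarrow> real" where
  "witness k = [5, 3, 4 * sqrt phi, 3 * sqrt phi, 5 * sqrt phi, 4] ! k"

lemma witness_eq_iff: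
  "a < 6 \<Longrightarrow> b < 6 \<Longrightarrow> witness b = sqrt phi * witness a \<longleftrightarrow> (a, b) \<in> {(0, 4), (1, 3), (5, 2)}"
proof -
  have "\<forall>a<6. \<forall>b<6. witness b = sqrt phi * witness a \<longleftrightarrow> (a, b) \<in> {(0, 4), (1, 3), (5, 2)}"
    using sqrt_phi_bounds phi_bounds
    unfolding all_less_6 witness_def by (auto simp: mult.left_commute [of "sqrt phi"])
  then show "a < 6 \<Longrightarrow> b < 6 \<Longrightarrow> ?thesis" by blast
qed

lemma witness_pos: "a < 6 \<Longrightarrow> 0 < witness a"
proof -
  have "\<forall>a<6. 0 < witness a"
    unfolding all_less_6 witness_def using phi_bounds by simp
  then show "a < 6 \<Longrightarrow> 0 < witness a" by blast
qed

definition witness_point :: "complex ^ 6" where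
  "witness_point = vector [5, 3, 4 * of_real (sqrt phi), 3 * of_real (sqrt phi), 5 * of_real (sqrt phi), 4]"

lemma coord_witness_point: "k < 6 \<Longrightarrow> coord witness_point k = of_real (witness k)"
proof -
  have "\<forall>k<6. coord witness_point k = of_real (witness k)"
    unfolding all_less_6 coord_simps witness_point_def vector_6 by (simp add: witness_def)
  then show "k < 6 \<Longrightarrow> ?thesis" by blast
qed

lemma witness_in_C_conic: "vec.span {witness_point} \<in> C_conic"
proof -
  have "witness_point $ 1 \<noteq> 0"
    by (simp add: witness_point_def vector_6)
  then have "witness_point \<noteq> 0"
    by (metis zero_index)
  then have "vec.span {witness_point} \<in> P5"
    unfolding P5_def by blast
  moreover have "(t *s witness_point) $ 1 = t * 5" "(t *s witness_point) $ 2 = t * 3"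
    "(t *s witness_point) $ 3 = t * (4 * of_real (sqrt phi))" "(t *s witness_point) $ 4 = t * (3 * of_real (sqrt phi))"
    "(t *s witness_point) $ 5 = t * (5 * of_real (sqrt phi))" "(t *s witness_point) $ 6 = t * 4" for t
    by (simp_all add: witness_point_def vector_6)
  ultimately show ?thesis
    unfolding C_conic_def proj_zeros_def vec.span_singleton
    by (auto simp: power2_eq_square simp del: vector_smult_component)
qed

lemma base_admissible: "base \<subseteq> admissible"
  by (auto simp: base_def admissible_def)

lemma relations_C_conic: "relations C_conic = base"
proof (intro equalityI subsetI)
  fix t assume "t \<in> base"
  then show "t \<in> relations C_conic"
    using base_admissible unfolding C_conic_eq realize_def relations_def by blast
next
  fix t assume t: "t \<in> relations C_conic"
  obtain a b c where abc: "t = (a, b, c)" "a < 6" "b < 6" "c < 4"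
    using t unfolding relations_def admissible_def by auto
  have "witness_point \<in> vec.span {witness_point}"
    by (simp add: vec.span_base)
  then have "holds witness_point (a, b, c)"
    using t witness_in_C_conic abc(1) unfolding relations_def by blast
  then have *: "complex_of_real (witness b) = \<i> ^ c * of_real (sqrt phi * witness a)"
    using abc by (simp add: coord_witness_point mult.assoc)
  \<comment> \<open>Absolute values remove the power of \<open>\<i>\<close>, and positivity then
    removes the bars; what is left of the equation forces that power to be 1.\<close>
  have "\<bar>witness b\<bar> = \<bar>sqrt phi * witness a\<bar>"
    using arg_cong [OF *, of cmod] by (simp only: norm_mult norm_power norm_ii norm_of_real) simp
  moreover have "0 < sqrt phi * witness a"
    using witness_pos [OF abc(2)] phi_bounds by simp
  ultimately have eq: "witness b = sqrt phi * witness a"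
    using witness_pos [OF abc(3)] by linarith
  then have "\<i> ^ c = 1"
    using * witness_pos [OF abc(2)] phi_bounds by simp
  moreover have "c = 0 \<or> c = 1 \<or> c = 2 \<or> c = 3"
    using abc(4) by linarith
  ultimately have "c = 0"
    by (auto simp: power3_eq_cube complex_eq_iff)
  then show "t \<in> base"
    using eq witness_eq_iff abc by (auto simp: base_def)
qed

section \<open>Closing the set of triples under the generators\<close>

definition moves :: "(nat \<times> nat) list list \<Rightarrow> (nat \<times> nat \<times> nat) set \<Rightarrow> (nat \<times> nat \<times> nat) set list" where
  "moves ms T = map (\<lambda>m. move m ` T) ms"

definition reachable :: "(nat \<times> nat) list list \<Rightarrow> (nat \<times> nat \<times> nat) set set" where
  "reachable ms = {(T, T'). T' \<in> set (moves ms T)}\<^sup>* `` {base}"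

lemma base_reachable: "base \<in> reachable ms"
  by (simp add: reachable_def)

lemma move_reachable: "T \<in> reachable ms \<Longrightarrow> m \<in> set ms \<Longrightarrow> move m ` T \<in> reachable ms"
  unfolding reachable_def moves_def by (auto intro: rtrancl_into_rtrancl)

lemma reachable_induct [consumes 1, case_names base move]:
  assumes "T \<in> reachable ms" and "P base"
    and "\<And>T m. T \<in> reachable ms \<Longrightarrow> m \<in> set ms \<Longrightarrow> P T \<Longrightarrow> P (move m ` T)"
  shows "P T"
proof -
  have "(base, T) \<in> {(T, T'). T' \<in> set (moves ms T)}\<^sup>*"
    using assms(1) by (simp add: reachable_def)
  then show ?thesis
  proof (induction rule: rtrancl_induct)
    case (step T T')
    then show ?case
      using assms(3) [of T] by (auto simp: reachable_def moves_def)
  qed (rule assms(2))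
qed

text \<open>An empty worklist means that the search has visited every reachable set and that
  \<open>P\<close> holds on all of them. Finiteness follows from \<open>0 < n\<close>, because
  infinite sets have cardinality 0.\<close>

lemma card_reachable:
  assumes "map_option (\<lambda>(ws, Z). (ws, card Z)) (rtrancl_while P (moves ms) base) = Some ([], n)" "0 < n"
  shows "finite (reachable ms)" "card (reachable ms) = n" "\<forall>T\<in>reachable ms. P T"
proof -
  obtain Z where Z: "rtrancl_while P (moves ms) base = Some ([], Z)" "card Z = n"
    using assms by auto
  then have "reachable ms = Z" and "\<forall>T\<in>reachable ms. P T"
    using rtrancl_while_Some [OF Z(1)] by (auto simp: reachable_def)
  then show "finite (reachable ms)" "card (reachable ms) = n" "\<forall>T\<in>reachable ms. P T"
    using Z assms(2) by (auto intro: card_ge_0_finite)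
qed

section \<open>Orbits under a group generated by monomial matrices\<close>

locale monomial_group =
  fixes ms :: "(nat \<times> nat) list list" and gs :: "(complex ^ 6 ^ 6) list"
  assumes monomials: "list_all2 monomial ms gs" and finite_reachable: "finite (reachable ms)"
begin

abbreviation H :: "(complex ^ 6 ^ 6) monoid" where
  "H \<equiv> GL6\<lparr>carrier := generate GL6 (set gs)\<rparr>"

lemma ex_generator: "m \<in> set ms \<Longrightarrow> \<exists>g\<in>set gs. monomial m g"
  using monomials by (induction rule: list_all2_induct) auto

lemma ex_monomial: "g \<in> set gs \<Longrightarrow> \<exists>m\<in>set ms. monomial m g"
  using monomials by (induction rule: list_all2_induct) auto

lemma generators_in_GL6: "set gs \<subseteq> carrier GL6"
  using ex_monomial by (auto simp: GL6_def intro: monomial_invertible)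

lemma orbit_H: "orbit H act_subset C_conic = (\<lambda>g. act_subset g C_conic) ` generate GL6 (set gs)"
  by (auto simp: orbit_def)

text \<open>A generator acts on \<open>realize T\<close> and on its relations through the same move,
  so along the induction \<open>T\<close> stays recoverable and its subset stays a translate of the
  conic.\<close>

lemma reachable_realize:
  assumes "T \<in> reachable ms"
  shows "T \<subseteq> admissible" "relations (realize T) = T"
    "\<exists>g\<in>generate GL6 (set gs). realize T = act_subset g C_conic"
proof -
  have "T \<subseteq> admissible \<and> relations (realize T) = T \<and>
    (\<exists>g\<in>generate GL6 (set gs). realize T = act_subset g C_conic)"
    using assms
  proof (induction rule: reachable_induct)
    case base
    have "act_subset \<one>\<^bsub>GL6\<^esub> C_conic = C_conic"
      by (simp add: GL6_def act_subset_one)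
    then show ?case
      using base_admissible relations_C_conic generate.one by (metis C_conic_eq)
  next
    case (move T m)
    then obtain g where g: "g \<in> generate GL6 (set gs)" "realize T = act_subset g C_conic"
      by blast
    obtain h where h: "monomial m h" "h \<in> set gs"
      using ex_generator move(2) by blast
    have *: "realize (move m ` T) = act_subset h (realize T)"
      using act_subset_realize [OF h(1)] move(3) by simp
    then have "realize (move m ` T) = act_subset (h ** g) C_conic"
      by (simp add: g(2) act_subset_mult)
    moreover have "h ** g \<in> generate GL6 (set gs)"
      using generate.eng [OF generate.incl [OF h(2)] g(1)] by (simp add: GL6_def)
    moreover have "relations (realize (move m ` T)) = move m ` T"
      using * move(3) by (simp add: relations_act_subset [OF h(1)])
    moreover have "move m ` T \<subseteq> admissible"
      using move(3) move_admissible [OF h(1)] by (intro image_subsetI) blast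
    ultimately show ?case by blast
  qed
  then show "T \<subseteq> admissible" "relations (realize T) = T"
    "\<exists>g\<in>generate GL6 (set gs). realize T = act_subset g C_conic"
    by blast+
qed

lemma inv_GL6:
  assumes "g \<in> carrier GL6"
  shows "act_subset (inv\<^bsub>GL6\<^esub> g) (act_subset g Y) = Y" "act_subset g (act_subset (inv\<^bsub>GL6\<^esub> g) Y) = Y"
  using group.l_inv [OF group_GL6 assms] group.r_inv [OF group_GL6 assms]
  by (simp_all add: GL6_def act_subset_one flip: act_subset_mult)

lemma orbit_eq: "orbit H act_subset C_conic = realize ` reachable ms"
proof (intro equalityI subsetI)
  fix Y assume "Y \<in> realize ` reachable ms"
  then show "Y \<in> orbit H act_subset C_conic"
    using reachable_realize(3) unfolding orbit_H by blast
next
  have generator: "act_subset g Y \<in> realize ` reachable ms"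
    if g: "g \<in> set gs" and Y: "Y \<in> realize ` reachable ms" for g Y
  proof -
    obtain m where "monomial m g" "m \<in> set ms"
      using ex_monomial g by blast
    moreover obtain T where "T \<in> reachable ms" "Y = realize T"
      using Y by blast
    ultimately show ?thesis
      by (simp add: act_subset_realize reachable_realize(1) move_reachable)
  qed
  have "act_subset g Y \<in> realize ` reachable ms"
    if "g \<in> generate GL6 (set gs)" and "Y \<in> realize ` reachable ms" for g Y
    using that
  proof (induction arbitrary: Y rule: generate.induct)
    case one
    then show ?case by (simp add: GL6_def act_subset_one)
  next
    case (incl h)
    then show ?case by (rule generator)
  next
    case (inv h)
    have h: "h \<in> carrier GL6"
      using inv(1) generators_in_GL6 by blast
    \<comment> \<open>Closure under inverses comes from finiteness: an injective map of a finite set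
      into itself is onto, so \<open>Y\<close> has a preimage in the set.\<close>
    have "inj_on (act_subset h) (realize ` reachable ms)"
      using inv_GL6(1) [OF h] by (metis inj_onI)
    then have "act_subset h ` realize ` reachable ms = realize ` reachable ms"
      using generator [OF inv(1)] finite_reachable by (intro endo_inj_surj) auto
    then obtain Z where "Z \<in> realize ` reachable ms" "Y = act_subset h Z"
      using inv(2) by blast
    then show ?case
      by (simp add: inv_GL6(1) [OF h])
  next
    case (eng h1 h2)
    then show ?case by (simp add: GL6_def act_subset_mult)
  qed
  moreover have "C_conic \<in> realize ` reachable ms"
    unfolding C_conic_eq using base_reachable by blast
  ultimately show "Y \<in> realize ` reachable ms" if "Y \<in> orbit H act_subset C_conic" for Y
    using that unfolding orbit_H by blast
qed

text \<open>\<open>realize\<close> is injective on reachable sets, with \<open>relations\<close> as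
  left inverse.\<close>

lemma card_orbit: "card (orbit H act_subset C_conic) = card (reachable ms)"
  unfolding orbit_eq by (intro card_image inj_onI) (metis reachable_realize(2))

lemma pairwise_disjnt_orbit:
  assumes "\<And>T. T \<in> reachable ms \<Longrightarrow> T \<noteq> base \<Longrightarrow> disjnt (realize base) (realize T)"
  shows "pairwise disjnt (orbit H act_subset C_conic)"
proof (rule pairwiseI)
  fix Y Z assume YZ: "Y \<in> orbit H act_subset C_conic" "Z \<in> orbit H act_subset C_conic" "Y \<noteq> Z"
  obtain g h where g: "g \<in> generate GL6 (set gs)" "Y = act_subset g C_conic"
    and h: "h \<in> generate GL6 (set gs)" "Z = act_subset h C_conic"
    using YZ unfolding orbit_H by blast
  \<comment> \<open>Homogeneity: \<open>Z\<close> is the image under \<open>g\<close> of the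
    translate of the conic by \<open>k\<close>, so it is enough to compare the conic with that
    translate.\<close>
  define k where "k = inv\<^bsub>GL6\<^esub> g ** h"
  have "k \<in> generate GL6 (set gs)"
    using generate.eng [OF group.generate_m_inv_closed [OF group_GL6 generators_in_GL6 g(1)] h(1)]
    by (simp add: k_def GL6_def)
  then obtain T where T: "T \<in> reachable ms" "act_subset k C_conic = realize T"
    using orbit_eq unfolding orbit_H by blast
  have gGL: "g \<in> carrier GL6"
    using g(1) group.generate_incl [OF group_GL6 generators_in_GL6] by blast
  have Z: "Z = act_subset g (realize T)"
    by (simp add: h(2) k_def act_subset_mult inv_GL6(2) [OF gGL] flip: T(2))
  have "T \<noteq> base"
    using YZ(3) Z g(2) C_conic_eq by auto
  then have "disjnt C_conic (realize T)"
    using assms T(1) C_conic_eq by simp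
  moreover have "act_point (inv\<^bsub>GL6\<^esub> g) (act_point g L) = L" for L
    using group.l_inv [OF group_GL6 gGL] by (simp add: GL6_def act_point_one flip: act_point_mult)
  then have "inj (act_point g)"
    by (rule inj_on_inverseI)
  ultimately show "disjnt Y Z"
    unfolding g(2) Z act_subset_def disjnt_def by (simp flip: image_Int)
qed

end

section \<open>Disjointness of the conic from its translates\<close>

text \<open>With \<open>x_k' = sqrt \<phi> x_k\<close> and likewise for \<open>l\<close> and \<open>m\<close>, two equations \<open>x_k' = - sqrt \<phi> x_k\<close> and
  \<open>x_l' = - sqrt \<phi> x_l\<close> kill two of the three free coordinates, and the quadric kills the third.
  Equations linking \<open>k\<close> to \<open>l\<close>, \<open>l'\<close> to \<open>m'\<close>, and \<open>k'\<close> to \<open>m\<close> express \<open>x_m\<close> in two ways as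
  \<open>\<phi> x_k\<close> times a power of \<open>\<i>\<close>.\<close>

definition conic_pairs :: "(nat \<times> nat \<times> nat \<times> nat \<times> nat \<times> nat) list" where
  "conic_pairs = [(0, 4, 1, 3, 5, 2), (1, 3, 5, 2, 0, 4), (5, 2, 0, 4, 1, 3)]"

definition incompatible :: "(nat \<times> nat \<times> nat) set \<Rightarrow> bool" where
  "incompatible T \<longleftrightarrow> (\<exists>(k, k', l, l', m, m') \<in> set conic_pairs.
    (k, k', 2) \<in> T \<and> (l, l', 2) \<in> T \<or>
    (\<exists>c1\<in>{0, 1, 2, 3}. \<exists>c2\<in>{0, 1, 2, 3}. \<exists>c3\<in>{0, 1, 2, 3}. (c1 + c2) mod 4 \<noteq> c3 \<and>
      (k, l, c1) \<in> T \<and> (l', m', c2) \<in> T \<and> (k', m, c3) \<in> T))"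

lemma i_power_eq_iff: "\<i> ^ m = \<i> ^ n \<longleftrightarrow> m mod 4 = n mod 4"
proof
  have "\<i> ^ j = \<i> ^ k \<Longrightarrow> j = k" if "j \<in> {0, 1, 2, 3}" "k \<in> {0, 1, 2, 3}" for j k :: nat
    using that by (auto simp: power3_eq_cube complex_eq_iff)
  moreover have "n mod 4 \<in> {0, 1, 2, 3}" for n :: nat
    by auto
  moreover assume "\<i> ^ m = \<i> ^ n"
  ultimately show "m mod 4 = n mod 4"
    by (metis i_power_mod_4)
qed (metis i_power_mod_4)

lemma disjnt_incompatible:
  assumes "incompatible T"
  shows "disjnt (realize base) (realize T)"
proof -
  define s :: complex where "s = of_real (sqrt phi)"
  have s: "s \<noteq> 0"
    using phi_bounds by (simp add: s_def)
  \<comment> \<open>A common point would be spanned by a nonzero vector satisfying both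
    systems.\<close>
  have zero: "x = 0" if base: "\<And>t. t \<in> base \<Longrightarrow> holds x t"
    and sq: "(x $ 1)\<^sup>2 - (x $ 2)\<^sup>2 - (x $ 6)\<^sup>2 = 0" and T: "\<And>t. t \<in> T \<Longrightarrow> holds x t" for x
  proof -
    have b: "x $ 5 = s * x $ 1" "x $ 4 = s * x $ 2" "x $ 3 = s * x $ 6"
      using base [of "(0, 4, 0)"] base [of "(1, 3, 0)"] base [of "(5, 2, 0)"]
      by (simp_all add: base_def s_def)
    have rel: "coord x j = \<i> ^ c * s * coord x i" if "(i, j, c) \<in> T" for i j c
      using T [OF that] by (simp add: s_def)
    obtain k k' l l' m m' where pairs: "(k, k', l, l', m, m') \<in> set conic_pairs"
      and inc: "(k, k', 2) \<in> T \<and> (l, l', 2) \<in> T \<or>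
        (\<exists>c1 c2 c3. (c1 + c2) mod 4 \<noteq> c3 \<and> c3 < 4 \<and>
          (k, l, c1) \<in> T \<and> (l', m', c2) \<in> T \<and> (k', m, c3) \<in> T)"
      using assms unfolding incompatible_def by fastforce
    \<comment> \<open>The three choices rotate the pairs cyclically. The quadric is a signed sum of
      squares, so any two vanishing free coordinates force the third to vanish.\<close>
    have p: "coord x k' = s * coord x k" "coord x l' = s * coord x l" "coord x m' = s * coord x m"
      and sq': "coord x k = 0 \<Longrightarrow> coord x l = 0 \<Longrightarrow> coord x m = 0"
      and x0: "coord x k = 0 \<Longrightarrow> coord x l = 0 \<Longrightarrow> coord x m = 0 \<Longrightarrow> x = 0"
      using pairs b sq by (auto simp: conic_pairs_def vec_eq_iff forall_6)
    from inc show "x = 0"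
    proof (elim disjE exE conjE)
      assume "(k, k', 2) \<in> T" "(l, l', 2) \<in> T"
      then have "s * coord x k = 0" "s * coord x l = 0"
        using rel [of k k' 2] rel [of l l' 2] p by simp_all
      then show ?thesis
        using s sq' x0 by simp
    next
      fix c1 c2 c3
      assume c: "(c1 + c2) mod 4 \<noteq> c3" "c3 < 4"
        and t: "(k, l, c1) \<in> T" "(l', m', c2) \<in> T" "(k', m, c3) \<in> T"
      \<comment> \<open>The left side is the coordinate \<open>m'\<close>, reached from
        \<open>k\<close> through \<open>l\<close> and \<open>l'\<close>; the next equation reaches
        \<open>m\<close> through \<open>k'\<close> instead.\<close>
      have "s * coord x m = s * (\<i> ^ (c1 + c2) * (s * s) * coord x k)"
        using rel [OF t(1)] rel [OF t(2)] p by (simp add: power_add ac_simps)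
      moreover have m: "coord x m = \<i> ^ c3 * (s * s) * coord x k"
        using rel [OF t(3)] p by simp
      ultimately have "(\<i> ^ (c1 + c2) - \<i> ^ c3) * (s * s) * coord x k = 0"
        using s by (auto simp: algebra_simps)
      moreover have "\<i> ^ (c1 + c2) \<noteq> \<i> ^ c3"
        using c by (simp add: i_power_eq_iff)
      ultimately have "coord x k = 0"
        using s by simp
      then show ?thesis
        using m rel [OF t(1)] x0 by simp
    qed
  qed
  have False if L: "L \<in> realize base" "L \<in> realize T" for L
  proof -
    obtain x where x: "x \<noteq> 0" "L = vec.span {x}"
      using L(1) unfolding realize_def P5_def by blast
    then have "x \<in> L"
      by (simp add: vec.span_base)
    moreover have "(x $ 1)\<^sup>2 - (x $ 2)\<^sup>2 - (x $ 6)\<^sup>2 = 0"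
      using L(1) \<open>x \<in> L\<close> unfolding C_conic_eq [symmetric] C_conic_def proj_zeros_def by simp
    ultimately show False
      using zero [of x] x(1) L unfolding realize_def by blast
  qed
  then show ?thesis
    unfolding disjnt_iff by blast
qed

section \<open>Enumeration for the two groups\<close>

definition moves_G :: "(nat \<times> nat) list list" where
  "moves_G = [[(0, 2), (1, 0), (2, 0), (3, 0), (4, 0), (5, 0)],
    [(0, 1), (2, 0), (1, 0), (3, 3), (5, 0), (4, 0)],
    [(1, 0), (2, 0), (3, 0), (5, 0), (4, 0), (0, 0)]]"

definition moves_A :: "(nat \<times> nat) list list" where
  "moves_A = [[(2, 2), (4, 1), (0, 0), (3, 1), (1, 1), (5, 3)],
    [(2, 3), (1, 3), (0, 3), (5, 3), (4, 1), (3, 3)],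
    [(0, 0), (1, 0), (2, 0), (3, 2), (4, 0), (5, 2)],
    [(0, 0), (1, 2), (2, 0), (3, 2), (4, 2), (5, 2)]]"

lemma rtrancl_while_moves_G:
  "map_option (\<lambda>(ws, Z). (ws, card Z)) (rtrancl_while (\<lambda>_. True) (moves moves_G) base) = Some ([], 80)"
  by code_simp

text \<open>The predicate is tested at each set visited, so a single search yields both the count
  and the criterion for disjointness from the conic.\<close>

lemma rtrancl_while_moves_A:
  "map_option (\<lambda>(ws, Z). (ws, card Z))
    (rtrancl_while (\<lambda>T. T = base \<or> incompatible T) (moves moves_A) base) = Some ([], 16)"
  by code_simp

interpretation G: monomial_group moves_G "[diag_matrix (vector [-1, 1, 1, 1, 1, 1]), mat_u, mat_v]"
proof
  show "list_all2 monomial moves_G [diag_matrix (vector [-1, 1, 1, 1, 1, 1]), mat_u, mat_v]"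
    using monomial_G_generators by (simp add: moves_G_def)
  show "finite (reachable moves_G)"
    using card_reachable(1) [OF rtrancl_while_moves_G] by simp
qed

interpretation A: monomial_group moves_A
  "[mat_a, mat_b, diag_matrix (vector [1, 1, 1, -1, 1, -1]), diag_matrix (vector [1, -1, 1, -1, -1, -1])]"
proof
  show "list_all2 monomial moves_A
    [mat_a, mat_b, diag_matrix (vector [1, 1, 1, -1, 1, -1]), diag_matrix (vector [1, -1, 1, -1, -1, -1])]"
    using monomial_A_generators by (simp add: moves_A_def)
  show "finite (reachable moves_A)"
    using card_reachable(1) [OF rtrancl_while_moves_A] by simp
qed

theorem mainTheorem12:
  shows "C_conic \<subseteq> X_BH
    \<and> card (orbit G_BH act_subset C_conic) = 80
    \<and> card (orbit A_grp act_subset C_conic) = 16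
    \<and> pairwise disjnt (orbit A_grp act_subset C_conic)"
proof (intro conjI)
  show "C_conic \<subseteq> X_BH"
    unfolding C_conic_eq realize_def X_BH_def proj_zeros_def on_X_def X_system_def by auto
  show "card (orbit G_BH act_subset C_conic) = 80"
    using G.card_orbit card_reachable(2) [OF rtrancl_while_moves_G] by (simp add: G_BH_def)
  show "card (orbit A_grp act_subset C_conic) = 16"
    using A.card_orbit card_reachable(2) [OF rtrancl_while_moves_A] by (simp add: A_grp_def)
  have "disjnt (realize base) (realize T)" if "T \<in> reachable moves_A" "T \<noteq> base" for T
    using card_reachable(3) [OF rtrancl_while_moves_A] that disjnt_incompatible by auto
  then show "pairwise disjnt (orbit A_grp act_subset C_conic)"
    using A.pairwise_disjnt_orbit by (simp add: A_grp_def)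
qed

end
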